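(* For every complex number $s$ with $\operatorname{Re} s > 1$, $$F(s) = h(s) - \zeta(s+1) + \psi(s)\zeta(s) + \zeta'(s),$$ where $$F(s) = \frac{\Gamma(1-s)}{2\pi i} \int_L \frac{z^{s-1} e^z}{e^z-1} \log\left(\frac{e^z-1}{z}\right) dz, \qquad h(s)=\sum_{n=1}^\infty \frac{H_n}{n^s},$$ $L$ is the Hankel contour around the negative real axis, $\zeta$ is the Riemann zeta function and $\psi=\Gamma'/\Gamma$. At the integers $s=2,3,\ldots$, where $\Gamma(1-s)$ has a pole, $F(s)$ is understood as the limiting value (analytic continuation) of $F$ at $s$.
   Context: $H_n = 1+\frac12+\cdots+\frac1n$ are the harmonic numbers; the series for $h(s)$ converges for $\operatorname{Re} s>1$. The Hankel contour is $L = L_-\cup L_\epsilon\cup L_+$ for a small $\epsilon>0$ ($\epsilon<2\pi$; the integral does not depend on $\epsilon$): $L_-$ is the lower side ($\arg z=-\pi$) of the ray $(-\infty,-\epsilon)$ traced from left to right; $L_\epsilon=\{\epsilon e^{i\theta}: -\pi\le\theta\le\pi\}$ is traced counterclockwise; $L_+$ is the upper side ($\arg z=\pi$) of the ray $(-\infty,-\epsilon)$ traced from right to left. The power is $z^{s-1}=\exp((s-1)(\log|z|+i\arg z))$ with the indicated values of $\arg z\in[-\pi,\pi]$. The function $\log\left(\frac{e^z-1}{z}\right)$ is the holomorphic branch which vanishes at $z=0$ and is real on the negative real axis (there $\frac{e^z-1}{z}>0$). *)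

theory Defs
  imports "HOL-Complex_Analysis.Complex_Analysis"
begin

(* The Dirichlet series; this is the Riemann zeta function on Re s > 1, and it is
   only meaningful there. *)
definition zeta :: "complex \<Rightarrow> complex" where
  "zeta s = (\<Sum>n. 1 / of_nat (Suc n) powr s)"

definition harmonic_zeta :: "complex \<Rightarrow> complex" where
  "harmonic_zeta s = (\<Sum>n. harm (Suc n) / of_nat (Suc n) powr s)"

definition psi :: "complex \<Rightarrow> complex" where
  "psi s = deriv Gamma s / Gamma s"

(* A convex domain that contains the contour (for \<epsilon> < 2 pi) and in which
   0 is the only zero of exp z - 1. *)
definition log_strip :: "complex set" where
  "log_strip = {z. \<bar>Im z\<bar> < 2 * pi}"

definition is_log_branch :: "(complex \<Rightarrow> complex) \<Rightarrow> bool" where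
  "is_log_branch g \<longleftrightarrow>
     g holomorphic_on log_strip \<and>
     (\<forall>z\<in>log_strip - {0}. exp (g z) = (exp z - 1) / z) \<and>
     g 0 = 0 \<and>
     (\<forall>x::real. x < 0 \<longrightarrow> g (of_real x) \<in> \<real>)"

(* Existence and uniqueness on the strip are shown in ex_log_branch and
   log_branch_unique below. *)
definition log_branch :: "complex \<Rightarrow> complex" where
  "log_branch = (SOME g. is_log_branch g)"

(* The integrand at the point z = r e^(i\<theta>) of the logarithmic surface: the power
   z^(s-1) depends on the choice of the argument \<theta>, the other factors only on z. *)
definition hankel_integrand :: "complex \<Rightarrow> real \<Rightarrow> real \<Rightarrow> complex" where
  "hankel_integrand s r \<theta> =
     (let z = rcis r \<theta>
      in exp ((s - 1) * (of_real (ln r) + \<i> * of_real \<theta>)) * exp z / (exp z - 1) * log_branch z)"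

(* The ray arg z = \<theta> traced outwards from |z| = \<epsilon>, so dz = e^(i\<theta>) dr. *)
definition hankel_ray :: "real \<Rightarrow> complex \<Rightarrow> real \<Rightarrow> complex" where
  "hankel_ray \<epsilon> s \<theta> = integral {\<epsilon>..} (\<lambda>r. hankel_integrand s r \<theta> * cis \<theta>)"

definition hankel_arc :: "real \<Rightarrow> complex \<Rightarrow> complex" where
  "hankel_arc \<epsilon> s =
     integral {-pi..pi} (\<lambda>\<theta>. hankel_integrand s \<epsilon> \<theta> * (\<i> * rcis \<epsilon> \<theta>))"

(* L_- (arg z = -pi) is traced inwards, hence the sign; L_+ (arg z = pi) outwards. *)
definition hankel_integral :: "real \<Rightarrow> complex \<Rightarrow> complex" where
  "hankel_integral \<epsilon> s = - hankel_ray \<epsilon> s (-pi) + hankel_arc \<epsilon> s + hankel_ray \<epsilon> s pi"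

(* The formula for F away from the poles of Gamma(1 - s). *)
definition hankel_F0 :: "real \<Rightarrow> complex \<Rightarrow> complex" where
  "hankel_F0 \<epsilon> s = Gamma (1 - s) / (2 * of_real pi * \<i>) * hankel_integral \<epsilon> s"

(* 1 - s \<in> \<int>\<^sub>\<le>\<^sub>0 means s = 1, 2, 3, ... *)
definition hankel_F :: "real \<Rightarrow> complex \<Rightarrow> complex" where
  "hankel_F \<epsilon> s =
     (if 1 - s \<in> \<int>\<^sub>\<le>\<^sub>0 then Lim (at s) (hankel_F0 \<epsilon>) else hankel_F0 \<epsilon> s)"

lemma exp_eq_1_continuous:
  fixes f :: "'a::topological_space \<Rightarrow> complex"
  assumes S: "connected S" "continuous_on S f" "\<And>x. x \<in> S \<Longrightarrow> exp (f x) = 1"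
    and a: "a \<in> S" "f a = 0" and x: "x \<in> S"
  shows "f x = 0"
proof -
  have *: "\<exists>e>0. \<forall>y. y \<in> S \<and> f y \<noteq> f x \<longrightarrow> e \<le> norm (f y - f x)" if "x \<in> S" for x
  proof (intro exI[of _ "2 * pi"] conjI allI impI)
    fix y assume y: "y \<in> S \<and> f y \<noteq> f x"
    have "exp (f y) = exp (f x)" using S(3) y that by simp
    then obtain n :: int where n: "f y = f x + (of_int (2 * n) * pi) * \<i>"
      by (metis exp_eq)
    with y have "n \<noteq> 0" by auto
    hence "1 \<le> \<bar>real_of_int n\<bar>" by linarith
    hence "2 * pi * 1 \<le> 2 * pi * \<bar>real_of_int n\<bar>"
      by (intro mult_left_mono) auto
    also have "\<dots> = norm (f y - f x)" by (simp add: n norm_mult)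
    finally show "2 * pi \<le> norm (f y - f x)" by simp
  qed auto
  have "f constant_on S"
    by (rule continuous_discrete_range_constant[OF S(1,2)]) (use * in blast)
  thus ?thesis using a x unfolding constant_on_def by metis
qed

lemma convex_log_strip: "convex log_strip"
proof -
  have "log_strip = {z. Im z < 2 * pi} \<inter> {z. Im z > - (2 * pi)}"
    by (auto simp: log_strip_def)
  thus ?thesis
    by (metis convex_Int convex_halfspace_Im_lt convex_halfspace_Im_gt)
qed

lemma open_log_strip: "open log_strip"
  unfolding log_strip_def by (intro open_Collect_less continuous_intros)

lemma zero_in_log_strip: "0 \<in> log_strip"
  by (simp add: log_strip_def)

lemma exp_eq_1_log_strip:
  assumes "z \<in> log_strip" "exp z = 1"
  shows "z = 0"
proof -
  obtain n :: int where n: "Re z = 0" "Im z = of_int (2 * n) * pi"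
    using assms(2) by (metis exp_eq_1)
  have "\<bar>real_of_int n\<bar> * (2 * pi) < 1 * (2 * pi)"
    using assms(1) n by (simp add: log_strip_def abs_mult)
  hence "\<bar>real_of_int n\<bar> < 1" by (rule mult_right_less_imp_less) simp
  hence "n = 0" by linarith
  thus ?thesis using n by (simp add: complex_eq_iff)
qed

lemma is_log_branch_unique:
  assumes "is_log_branch f" "is_log_branch g" "z \<in> log_strip"
  shows "f z = g z"
proof -
  have "f z - g z = 0"
  proof (rule exp_eq_1_continuous[where S = log_strip and a = 0 and f = "\<lambda>z. f z - g z"])
    show "connected log_strip" by (simp add: convex_connected convex_log_strip)
    show "continuous_on log_strip (\<lambda>z. f z - g z)"
      using assms unfolding is_log_branch_def
      by (blast intro: continuous_on_diff holomorphic_on_imp_continuous_on)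
    show "exp (f w - g w) = 1" if "w \<in> log_strip" for w
    proof (cases "w = 0")
      case False
      hence "exp (f w) = exp (g w)" using assms that by (simp add: is_log_branch_def)
      thus ?thesis by (simp add: exp_diff)
    qed (use assms in \<open>simp add: is_log_branch_def\<close>)
  qed (use assms in \<open>auto simp: is_log_branch_def zero_in_log_strip\<close>)
  thus ?thesis by simp
qed

lemma ex_log_branch: "\<exists>g. is_log_branch g"
proof -
  define q :: "complex \<Rightarrow> complex" where "q = (\<lambda>z. if z = 0 then 1 else (exp z - 1) / z)"
  have lim: "q \<midarrow>0\<rightarrow> 1"
  proof -
    have "((\<lambda>z::complex. exp z) has_field_derivative 1) (at 0)"
      by (auto intro!: derivative_eq_intros)
    hence "((\<lambda>z::complex. (exp z - 1) / z) \<longlongrightarrow> 1) (at 0)"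
      by (simp add: has_field_derivative_iff)
    thus ?thesis
      by (rule Lim_transform_eventually)
        (auto simp: q_def eventually_at intro: exI[of _ 1])
  qed
  have "q holomorphic_on log_strip"
  proof (rule no_isolated_singularity'[where K = "{0}"])
    have "(\<lambda>z. (exp z - 1) / z) holomorphic_on log_strip - {0}"
      by (intro holomorphic_intros) auto
    thus "q holomorphic_on log_strip - {0}"
      by (rule holomorphic_transform) (auto simp: q_def)
    show "(q \<longlongrightarrow> q z) (at z within log_strip)" if "z \<in> {0}" for z
      using that lim by (auto simp: q_def intro: tendsto_within_subset)
  qed (auto simp: open_log_strip)
  moreover have "contractible log_strip"
    by (simp add: convex_imp_contractible convex_log_strip)
  moreover have "q z \<noteq> 0" if "z \<in> log_strip" for z
    using exp_eq_1_log_strip[OF that] by (auto simp: q_def)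
  ultimately obtain h where h: "h holomorphic_on log_strip"
      "\<And>z. z \<in> log_strip \<Longrightarrow> q z = exp (h z)"
    using contractible_imp_holomorphic_log[of q log_strip] by metis
  define g where "g = (\<lambda>z. h z - h 0)"
  have hol: "g holomorphic_on log_strip"
    unfolding g_def by (intro holomorphic_intros h)
  have g0: "g 0 = 0" by (simp add: g_def)
  have "exp (h 0) = 1" using h(2)[OF zero_in_log_strip] by (simp add: q_def)
  hence exp_g: "exp (g z) = q z" if "z \<in> log_strip" for z
    using h(2)[OF that] by (simp add: g_def exp_diff)
  have real: "g (of_real x) \<in> \<real>" if "x < 0" for x :: real
  proof -
    have "\<i> * of_real (Im (g (of_real x))) = 0"
    proof (rule exp_eq_1_continuous[where S = "{..0}" and a = "0::real"
          and f = "\<lambda>x. \<i> * of_real (Im (g (of_real x)))"])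
      have "continuous_on {..0::real} (\<lambda>x. g (of_real x))"
        by (rule continuous_on_compose2[OF holomorphic_on_imp_continuous_on[OF hol]])
          (auto intro!: continuous_intros simp: log_strip_def)
      thus "continuous_on {..0::real} (\<lambda>x. \<i> * of_real (Im (g (of_real x))))"
        by (intro continuous_intros)
      fix y :: real assume "y \<in> {..0}"
      define p :: real where "p = (if y = 0 then 1 else (exp y - 1) / y)"
      have "p > 0" using \<open>y \<in> {..0}\<close>
        by (auto simp: p_def intro: divide_neg_neg)
      have "exp (g (of_real y)) = of_real p"
        by (subst exp_g) (auto simp: log_strip_def q_def p_def simp flip: exp_of_real)
      hence "of_real (exp (Re (g (of_real y)))) * cis (Im (g (of_real y))) = complex_of_real p"
        by (simp add: exp_eq_polar)
      moreover from this have "exp (Re (g (of_real y))) = p"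
        using \<open>p > 0\<close> by (metis abs_of_pos norm_of_real norm_exp_eq_Re exp_eq_polar)
      ultimately have "cis (Im (g (of_real y))) = 1" using \<open>p > 0\<close> by simp
      thus "exp (\<i> * of_real (Im (g (of_real y)))) = 1" by (simp add: cis_conv_exp)
    qed (use that g0 in auto)
    thus ?thesis by (simp add: complex_is_Real_iff)
  qed
  have "is_log_branch g"
    unfolding is_log_branch_def using hol exp_g g0 real by (auto simp: q_def)
  thus ?thesis by blast
qed

lemma log_branch: "is_log_branch log_branch"
  unfolding log_branch_def by (rule someI_ex[OF ex_log_branch])

lemma log_branch_unique:
  "is_log_branch g \<Longrightarrow> z \<in> log_strip \<Longrightarrow> g z = log_branch z"
  using is_log_branch_unique log_branch by blast

end

theory Submission
  imports Defs
begin

text \<open>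
  Write the integrand as $z^{s-2}\chi(z)$ with $\chi$ holomorphic near the disc of radius $\epsilon$.
  The antiderivative of $z^{s-2}\chi(z)$ on the logarithmic surface has the form $z^{s-1}\Phi(z)$ with
  $\Phi$ holomorphic and tends to $0$ at the branch point, so the contour collapses onto the two sides
  of the negative axis. The reflection formula then turns $F(s)$ into
  \[ \frac{1}{\Gamma(s)}\int_0^\infty \frac{r^{s-1}}{e^r-1}\bigl(\ln r-\ln(1-e^{-r})\bigr)\,dr . \]
  Expanding $-\ln(1-e^{-r})/(e^r-1)=\sum_n H_n e^{-(n+1)r}$ gives $h(s)-\zeta(s+1)$, and the term with
  $\ln r$ is the derivative of $\int_0^\infty r^{s-1}/(e^r-1)\,dr=\Gamma(s)\zeta(s)$. The integral is
  continuous in $s$, which gives the limits at the poles of $\Gamma(1-s)$.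
\<close>

section \<open>Mellin transforms of exponential series\<close>

text \<open>Substitution \<open>t = a * r\<close> in Euler's integral; the change of variables
  theorem is fed with its absolute integrability.\<close>

lemma Gamma_integral_scaled:
  fixes a :: real and s :: complex
  assumes "a > 0" "Re s > 0"
  shows "((\<lambda>r. of_real r powr (s - 1) * of_real (exp (- (a * r)))) has_integral
           Gamma s / of_real a powr s) {0<..}"
proof -
  let ?f = "\<lambda>t. of_real t powr (s - 1) / complex_of_real (exp t)"
  have image: "(\<lambda>r. a * r) ` {0<..} = {0<..}"
  proof (intro equalityI subsetI)
    fix x :: real assume "x \<in> {0<..}"
    thus "x \<in> (\<lambda>r. a * r) ` {0<..}"
      using assms by (intro image_eqI[of _ _ "x / a"]) auto
  qed (use assms in auto)
  have "(\<lambda>r. \<bar>a\<bar> *\<^sub>R ?f (a * r)) absolutely_integrable_on {0<..} \<and>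
        integral {0<..} (\<lambda>r. \<bar>a\<bar> *\<^sub>R ?f (a * r)) = Gamma s"
    using absolutely_integrable_Gamma_integral'[OF assms(2)] Gamma_integral_complex'[OF assms(2)]
    by (subst has_absolute_integral_change_of_variables_real)
       (use assms in \<open>auto simp: image integral_unique inj_on_def intro!: derivative_eq_intros\<close>)
  hence "((\<lambda>r. \<bar>a\<bar> *\<^sub>R ?f (a * r)) has_integral Gamma s) {0<..}"
    using set_lebesgue_integral_eq_integral(1) integrable_integral by metis
  hence eq: "((\<lambda>r. (1 / of_real a powr s) * (\<bar>a\<bar> *\<^sub>R ?f (a * r))) has_integral
           (1 / of_real a powr s) * Gamma s) {0<..}"
    by (rule has_integral_mult_right)
  have "(1 / of_real a powr s) * (\<bar>a\<bar> *\<^sub>R ?f (a * r)) =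
      of_real r powr (s - 1) * of_real (exp (- (a * r)))" if "r \<in> {0<..}" for r
  proof -
    have r: "r > 0" using that by simp
    have "complex_of_real (a * r) powr (s - 1) = of_real a powr (s - 1) * of_real r powr (s - 1)"
      using assms r by (simp add: powr_times_real)
    moreover have "complex_of_real a powr s = of_real a powr (s - 1) * of_real a"
      using assms powr_add[of "complex_of_real a" "s - 1" 1] by simp
    ultimately show ?thesis
      using assms r by (simp add: exp_minus field_simps scaleR_conv_of_real)
  qed
  from has_integral_eq[OF this eq] show ?thesis by simp
qed

lemma Gamma_integral_scaled_real:
  fixes a \<sigma> :: real
  assumes "a > 0" "\<sigma> > 0"
  shows "((\<lambda>r. r powr (\<sigma> - 1) * exp (- (a * r))) has_integral Gamma \<sigma> / a powr \<sigma>) {0<..}"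
proof -
  have "((\<lambda>r. complex_of_real r powr (of_real \<sigma> - 1) * of_real (exp (- (a * r)))) has_integral
           Gamma (of_real \<sigma>) / of_real a powr of_real \<sigma>) {0<..}"
    using assms by (intro Gamma_integral_scaled) auto
  moreover have "complex_of_real r powr (of_real \<sigma> - 1) * of_real (exp (- (a * r))) =
      of_real (r powr (\<sigma> - 1) * exp (- (a * r)))" if "r \<in> {0<..}" for r
    using that powr_of_real[of r "\<sigma> - 1"] by simp
  ultimately have "((\<lambda>r. complex_of_real (r powr (\<sigma> - 1) * exp (- (a * r)))) has_integral
           Gamma (of_real \<sigma>) / of_real a powr of_real \<sigma>) {0<..}"
    by (simp only: cong: has_integral_cong)
  moreover have "Gamma (of_real \<sigma>) / complex_of_real a powr of_real \<sigma> = of_real (Gamma \<sigma> / a powr \<sigma>)"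
    using assms by (simp add: Gamma_complex_of_real powr_of_real)
  ultimately have "((\<lambda>r. complex_of_real (r powr (\<sigma> - 1) * exp (- (a * r)))) has_integral
           of_real (Gamma \<sigma> / a powr \<sigma>)) {0<..}"
    by (simp only:)
  from has_integral_Re[OF this] show ?thesis by simp
qed

text \<open>Nonnegative coefficients make the partial sums increase, so monotone convergence
  integrates the series term by term. The function obtained serves as the dominating function in the
  complex version.\<close>

lemma integrable_powr_mult_exp_series:
  fixes c :: "nat \<Rightarrow> real" and \<sigma> :: real
  assumes "\<sigma> > 0" "\<And>n. c n \<ge> 0" "summable (\<lambda>n. c n / real (Suc n) powr \<sigma>)"
    and g: "\<And>r. r > 0 \<Longrightarrow> (\<lambda>n. c n * exp (- (real (Suc n) * r))) sums g r"
  shows "(\<lambda>r. r powr (\<sigma> - 1) * g r) integrable_on {0<..}"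
proof -
  let ?f = "\<lambda>N r. \<Sum>n<N. c n * (r powr (\<sigma> - 1) * exp (- (real (Suc n) * r)))"
  have "((\<lambda>r. r powr (\<sigma> - 1) * g r) has_integral
          (\<Sum>n. c n * (Gamma \<sigma> / real (Suc n) powr \<sigma>))) {0<..}"
  proof (rule has_integral_monotone_convergence_increasing)
    show "(?f N has_integral (\<Sum>n<N. c n * (Gamma \<sigma> / real (Suc n) powr \<sigma>))) {0<..}" for N
      using assms(1)
      by (intro has_integral_sum has_integral_mult_right Gamma_integral_scaled_real) auto
    show "?f N r \<le> ?f (Suc N) r" for N r
      using assms(2) by simp
    show "(\<lambda>N. ?f N r) \<longlonglongrightarrow> r powr (\<sigma> - 1) * g r" if "r \<in> {0<..}" for r
      using sums_mult[OF g, of r "r powr (\<sigma> - 1)"] that by (simp add: sums_def mult_ac)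
    show "(\<lambda>N. \<Sum>n<N. c n * (Gamma \<sigma> / real (Suc n) powr \<sigma>)) \<longlonglongrightarrow>
            (\<Sum>n. c n * (Gamma \<sigma> / real (Suc n) powr \<sigma>))"
      using summable_mult[OF assms(3), of "Gamma \<sigma>"] by (intro summable_LIMSEQ) (simp add: mult_ac)
  qed
  thus ?thesis by blast
qed

lemma norm_of_real_powr:
  "r > 0 \<Longrightarrow> norm (complex_of_real r powr s) = r powr Re s"
  by (simp add: norm_powr_real_powr)

lemma summable_complex_dirichlet:
  assumes "summable (\<lambda>n. c n / real (Suc n) powr Re s)" "\<And>n. c n \<ge> 0"
  shows "summable (\<lambda>n. of_real (c n) / complex_of_nat (Suc n) powr s)"
proof (rule summable_norm_cancel)
  have "norm (of_real (c n) / complex_of_nat (Suc n) powr s) = c n / real (Suc n) powr Re s" for n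
    using norm_of_real_powr[of "real (Suc n)" s] assms(2)[of n] by (simp add: norm_divide)
  thus "summable (\<lambda>n. norm (of_real (c n) / complex_of_nat (Suc n) powr s))"
    using assms(1) by simp
qed

text \<open>This is the passage from an exponential series to the Dirichlet series with the same
  coefficients. Since the terms are nonnegative, every partial sum is at most \<open>g r\<close>,
  and dominated convergence applies.\<close>

lemma has_integral_powr_mult_exp_series:
  fixes c :: "nat \<Rightarrow> real" and s :: complex
  assumes "Re s > 0" "\<And>n. c n \<ge> 0" "summable (\<lambda>n. c n / real (Suc n) powr Re s)"
    and g: "\<And>r. r > 0 \<Longrightarrow> (\<lambda>n. c n * exp (- (real (Suc n) * r))) sums g r"
  shows "((\<lambda>r. of_real r powr (s - 1) * of_real (g r)) has_integral
           Gamma s * (\<Sum>n. of_real (c n) / of_nat (Suc n) powr s)) {0<..}"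
proof -
  let ?f = "\<lambda>N r. \<Sum>n<N. of_real (c n) * (of_real r powr (s - 1) * complex_of_real (exp (- (real (Suc n) * r))))"
  show ?thesis
  proof (rule has_integral_dominated_convergence)
    show "(?f N has_integral (\<Sum>n<N. of_real (c n) * (Gamma s / of_real (real (Suc n)) powr s))) {0<..}" for N
      using assms(1)
      by (intro has_integral_sum has_integral_mult_right Gamma_integral_scaled) auto
    show "(\<lambda>r. r powr (Re s - 1) * g r) integrable_on {0<..}"
      by (rule integrable_powr_mult_exp_series) (use assms in auto)
    show "\<forall>r\<in>{0<..}. norm (?f N r) \<le> r powr (Re s - 1) * g r" for N
    proof
      fix r :: real assume r: "r \<in> {0<..}"
      have "norm (?f N r) = norm (of_real r powr (s - 1) * complex_of_real (\<Sum>n<N. c n * exp (- (real (Suc n) * r))))"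
        by (simp add: sum_distrib_left mult_ac)
      also have "\<dots> = r powr (Re s - 1) * \<bar>\<Sum>n<N. c n * exp (- (real (Suc n) * r))\<bar>"
        using r by (simp only: norm_mult norm_of_real) (simp add: norm_of_real_powr)
      also have "\<bar>\<Sum>n<N. c n * exp (- (real (Suc n) * r))\<bar> = (\<Sum>n<N. c n * exp (- (real (Suc n) * r)))"
        using assms(2) by (intro abs_of_nonneg sum_nonneg) auto
      also have "\<dots> \<le> g r"
      proof -
        have "(\<lambda>n. c n * exp (- (real (Suc n) * r))) sums g r" using g r by simp
        thus ?thesis
          using assms(2) sum_le_suminf[of "\<lambda>n. c n * exp (- (real (Suc n) * r))" "{..<N}"]
          by (simp add: sums_iff)
      qed
      finally show "norm (?f N r) \<le> r powr (Re s - 1) * g r" by (simp add: mult_left_mono)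
    qed
    show "\<forall>r\<in>{0<..}. (\<lambda>N. ?f N r) \<longlonglongrightarrow> of_real r powr (s - 1) * of_real (g r)"
    proof
      fix r :: real assume r: "r \<in> {0<..}"
      have "(\<lambda>n. complex_of_real (c n * exp (- (real (Suc n) * r)))) sums of_real (g r)"
        using g[of r] r by (intro sums_of_real) auto
      from sums_mult[OF this, of "of_real r powr (s - 1)"]
      show "(\<lambda>N. ?f N r) \<longlonglongrightarrow> of_real r powr (s - 1) * of_real (g r)"
        by (simp add: sums_def mult_ac)
    qed
    have "summable (\<lambda>n. of_real (c n) / complex_of_nat (Suc n) powr s)"
      using assms(3,2) by (rule summable_complex_dirichlet)
    hence "(\<lambda>n. Gamma s * (of_real (c n) / complex_of_nat (Suc n) powr s)) sums
             (Gamma s * (\<Sum>n. of_real (c n) / of_nat (Suc n) powr s))"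
      by (intro sums_mult summable_sums)
    thus "(\<lambda>N. \<Sum>n<N. of_real (c n) * (Gamma s / of_real (real (Suc n)) powr s)) \<longlonglongrightarrow>
        Gamma s * (\<Sum>n. of_real (c n) / of_nat (Suc n) powr s)"
      by (simp add: sums_def mult_ac)
  qed
qed

section \<open>Differentiation of Mellin transforms\<close>

definition mellin :: "(real \<Rightarrow> real) \<Rightarrow> complex \<Rightarrow> complex" where
  "mellin g s = integral {0<..} (\<lambda>r. of_real r powr (s - 1) * of_real (g r))"

lemma continuous_on_of_real_powr:
  "continuous_on {0<..} (\<lambda>r. complex_of_real r powr s)"
  by (intro continuous_intros) (auto simp: complex_nonpos_Reals_iff)

text \<open>The hypothesis is on the norm of the integrand, which depends on \<open>s\<close> only
  through \<open>Re s\<close>; continuity supplies measurability.\<close>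

lemma mellin_integrable:
  assumes g: "continuous_on {0<..} g"
    and int: "(\<lambda>r. r powr (Re s - 1) * \<bar>g r\<bar>) integrable_on {0<..}"
  shows "(\<lambda>r. of_real r powr (s - 1) * complex_of_real (g r)) integrable_on {0<..}"
proof (rule measurable_bounded_by_integrable_imp_integrable[OF _ int])
  show "(\<lambda>r. of_real r powr (s - 1) * complex_of_real (g r)) \<in> borel_measurable (lebesgue_on {0<..})"
    by (intro continuous_imp_measurable_on_sets_lebesgue continuous_on_mult
          continuous_on_of_real_powr continuous_on_of_real g) auto
qed (auto simp: norm_mult norm_of_real_powr)

text \<open>A logarithm costs an arbitrarily small power at each end: \<open>r powr \<delta>\<close>
  pays for large \<open>r\<close>, \<open>r powr (-\<delta>)\<close> for small
  \<open>r\<close>.\<close>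

lemma abs_ln_le_powr:
  fixes r \<delta> :: real
  assumes "r > 0" "\<delta> > 0"
  shows "\<bar>ln r\<bar> \<le> (r powr \<delta> + r powr (-\<delta>)) / \<delta>"
proof (cases "r \<ge> 1")
  case True
  have "\<bar>ln r\<bar> \<le> r powr \<delta> / \<delta>"
    using ln_powr_bound[of r \<delta>] assms True by simp
  also have "\<dots> \<le> (r powr \<delta> + r powr (-\<delta>)) / \<delta>"
    using assms by (intro divide_right_mono) auto
  finally show ?thesis .
next
  case False
  hence "ln (1 / r) \<le> (1 / r) powr \<delta> / \<delta>"
    using assms by (intro ln_powr_bound) auto
  hence "\<bar>ln r\<bar> \<le> r powr (-\<delta>) / \<delta>"
    using assms False by (simp add: ln_div powr_minus powr_divide inverse_eq_divide)
  also have "\<dots> \<le> (r powr \<delta> + r powr (-\<delta>)) / \<delta>"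
    using assms by (intro divide_right_mono) auto
  finally show ?thesis .
qed

text \<open>The range of admissible exponents is open, so the exponent can be moved by \<delta> in
  both directions, which absorbs the logarithm.\<close>

lemma integrable_powr_mult_ln:
  fixes a \<sigma> :: real
  assumes g: "continuous_on {0<..} g"
    and int: "\<And>\<sigma>. \<sigma> > a \<Longrightarrow> (\<lambda>r. r powr (\<sigma> - 1) * \<bar>g r\<bar>) integrable_on {0<..}"
    and "\<sigma> > a"
  shows "(\<lambda>r. r powr (\<sigma> - 1) * \<bar>ln r * g r\<bar>) integrable_on {0<..}"
proof -
  \<comment> \<open>Half the distance to the boundary keeps \<open>\<sigma> - \<delta>\<close> above
    \<open>a\<close>.\<close>
  define \<delta> where "\<delta> = (\<sigma> - a) / 2"
  have \<delta>: "\<delta> > 0" "\<sigma> - \<delta> > a" using assms(3) by (auto simp: \<delta>_def field_simps)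
  have "(\<lambda>r. (1 / \<delta>) * (r powr (\<sigma> + \<delta> - 1) * \<bar>g r\<bar> + r powr (\<sigma> - \<delta> - 1) * \<bar>g r\<bar>))
          integrable_on {0<..}"
    using int[of "\<sigma> + \<delta>"] int[of "\<sigma> - \<delta>"] \<delta>
    by (intro integrable_on_mult_right integrable_add) auto
  thus ?thesis
  proof (rule measurable_bounded_by_integrable_imp_integrable[rotated])
    show "(\<lambda>r. r powr (\<sigma> - 1) * \<bar>ln r * g r\<bar>) \<in> borel_measurable (lebesgue_on {0<..})"
      by (intro continuous_imp_measurable_on_sets_lebesgue continuous_intros g) auto
    fix r :: real assume r: "r \<in> {0<..}"
    have "norm (r powr (\<sigma> - 1) * \<bar>ln r * g r\<bar>) = r powr (\<sigma> - 1) * \<bar>g r\<bar> * \<bar>ln r\<bar>"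
      by (simp add: abs_mult)
    also have "\<dots> \<le> r powr (\<sigma> - 1) * \<bar>g r\<bar> * ((r powr \<delta> + r powr (-\<delta>)) / \<delta>)"
      using r \<delta> by (intro mult_left_mono abs_ln_le_powr) auto
    also have "\<dots> = (1 / \<delta>) * (r powr (\<sigma> + \<delta> - 1) * \<bar>g r\<bar> + r powr (\<sigma> - \<delta> - 1) * \<bar>g r\<bar>)"
    proof -
      have "r powr (\<sigma> + \<delta> - 1) = r powr (\<sigma> - 1) * r powr \<delta>"
           "r powr (\<sigma> - \<delta> - 1) = r powr (\<sigma> - 1) * r powr (-\<delta>)"
        by (simp_all add: algebra_simps flip: powr_add)
      thus ?thesis by (simp add: field_simps)
    qed
    finally show "norm (r powr (\<sigma> - 1) * \<bar>ln r * g r\<bar>) \<le>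
      (1 / \<delta>) * (r powr (\<sigma> + \<delta> - 1) * \<bar>g r\<bar> + r powr (\<sigma> - \<delta> - 1) * \<bar>g r\<bar>)" .
  qed auto
qed

lemma has_field_derivative_of_real_powr:
  assumes "r > 0"
  shows "((\<lambda>z. of_real r powr (z - 1)) has_field_derivative
           of_real (ln r) * complex_of_real r powr (z - 1)) (at z within S)"
proof -
  have "complex_of_real r powr (w - 1) = exp ((w - 1) * of_real (ln r))" for w
    using assms by (simp add: powr_def Ln_of_real)
  moreover have "((\<lambda>w. exp ((w - 1) * of_real (ln r))) has_field_derivative
      of_real (ln r) * exp ((z - 1) * of_real (ln r))) (at z within S)"
    by (auto intro!: derivative_eq_intros)
  ultimately show ?thesis by simp
qed

text \<open>Mean value inequality in the exponent over the closed ball around \<open>s\<close>.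
  Whether \<open>r powr x\<close> grows or decays in \<open>x\<close> depends on whether
  \<open>r\<close> exceeds 1; the sum of the two extreme powers covers both cases.\<close>

lemma norm_powr_diff_le:
  assumes "r > 0" "norm (w - s) \<le> \<delta>"
  shows "norm (of_real r powr (w - 1) - complex_of_real r powr (s - 1)) \<le>
           \<bar>ln r\<bar> * (r powr (Re s + \<delta> - 1) + r powr (Re s - \<delta> - 1)) * norm (w - s)"
proof (rule field_differentiable_bound[where S = "cball s \<delta>"
         and f' = "\<lambda>z. of_real (ln r) * of_real r powr (z - 1)"])
  show "((\<lambda>z. of_real r powr (z - 1)) has_field_derivative of_real (ln r) * of_real r powr (z - 1))
          (at z within cball s \<delta>)" for z
    using assms(1) by (rule has_field_derivative_of_real_powr)
  fix z assume z: "z \<in> cball s \<delta>"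
  have *: "\<bar>Re z - Re s\<bar> \<le> \<delta>"
    using z abs_Re_le_cmod[of "z - s"] by (simp add: dist_norm norm_minus_commute)
  have "r powr (Re z - 1) \<le> r powr (Re s + \<delta> - 1) + r powr (Re s - \<delta> - 1)"
  proof (cases "r \<ge> 1")
    case True
    thus ?thesis using * by (intro add_increasing2 powr_mono) auto
  next
    case False
    thus ?thesis using * assms(1) by (intro add_increasing powr_mono') auto
  qed
  thus "norm (of_real (ln r) * of_real r powr (z - 1)) \<le>
      \<bar>ln r\<bar> * (r powr (Re s + \<delta> - 1) + r powr (Re s - \<delta> - 1))"
    using assms(1) by (simp add: norm_mult norm_of_real_powr mult_left_mono)
next
  have "0 \<le> \<delta>" using assms(2) norm_ge_zero order_trans by blast
  thus "s \<in> cball s \<delta>" by simp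
qed (use assms in \<open>auto simp: dist_norm norm_minus_commute\<close>)

text \<open>Differentiation under the integral sign: by \<open>norm_powr_diff_le\<close> the
  difference quotients have an integrable bound that is independent of the increment.\<close>

lemma mellin_has_field_derivative:
  assumes g: "continuous_on {0<..} g"
    and int: "\<And>\<sigma>. \<sigma> > a \<Longrightarrow> (\<lambda>r. r powr (\<sigma> - 1) * \<bar>g r\<bar>) integrable_on {0<..}"
    and "Re s > a"
  shows "(mellin g has_field_derivative mellin (\<lambda>r. ln r * g r) s) (at s)"
proof -
  define \<delta> where "\<delta> = (Re s - a) / 2"
  have \<delta>: "\<delta> > 0" "Re s - \<delta> > a" using assms(3) by (auto simp: \<delta>_def field_simps)
  have integrable: "(\<lambda>r. of_real r powr (w - 1) * complex_of_real (g r)) integrable_on {0<..}"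
    if "Re w > a" for w
    using mellin_integrable[OF g int[OF that]] .
  have Re_gt: "Re w > a" if "w \<in> ball s \<delta>" for w
    using that \<delta>(2) abs_Re_le_cmod[of "w - s"] by (auto simp: dist_norm norm_minus_commute)
  \<comment> \<open>The common bound for all difference quotients; it is integrable because both
    shifted exponents still exceed \<open>a\<close>.\<close>
  define h where "h = (\<lambda>r. r powr (Re s + \<delta> - 1) * \<bar>ln r * g r\<bar> + r powr (Re s - \<delta> - 1) * \<bar>ln r * g r\<bar>)"
  have h: "h integrable_on {0<..}"
    unfolding h_def
    using integrable_powr_mult_ln[OF g int, of a "Re s + \<delta>"] integrable_powr_mult_ln[OF g int, of a "Re s - \<delta>"] \<delta>
    by (intro integrable_add) auto
  have "((\<lambda>w. (mellin g w - mellin g s) / (w - s)) \<longlongrightarrow> mellin (\<lambda>r. ln r * g r) s)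
          (at s within ball s \<delta>)"
    \<comment> \<open>Dominated convergence speaks of sequences, so the limit is tested along an
      arbitrary sequence \<open>X\<close> in the punctured ball.\<close>
    unfolding tendsto_at_iff_sequentially o_def
  proof (intro allI impI)
    fix X :: "nat \<Rightarrow> complex"
    assume X: "\<forall>i. X i \<in> ball s \<delta> - {s}" "X \<longlonglongrightarrow> s"
    let ?q = "\<lambda>k r. (of_real r powr (X k - 1) - of_real r powr (s - 1)) / (X k - s) * complex_of_real (g r)"
    have q_has: "(?q k has_integral (mellin g (X k) - mellin g s) / (X k - s)) {0<..}" for k
    proof -
      have "((\<lambda>r. (of_real r powr (X k - 1) * complex_of_real (g r) - of_real r powr (s - 1) * complex_of_real (g r))
              / (X k - s)) has_integral (mellin g (X k) - mellin g s) / (X k - s)) {0<..}"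
        unfolding mellin_def using X Re_gt assms(3)
        by (intro has_integral_divide has_integral_diff integrable_integral integrable) auto
      thus ?thesis by (simp add: algebra_simps)
    qed
    have "(\<lambda>k. integral {0<..} (?q k)) \<longlonglongrightarrow>
            integral {0<..} (\<lambda>r. of_real r powr (s - 1) * complex_of_real (ln r * g r))"
    proof (rule dominated_convergence(2)[OF _ h])
      show "?q k integrable_on {0<..}" for k using q_has by blast
      show "norm (?q k r) \<le> h r" if r: "r \<in> {0<..}" for k r
      proof -
        have "X k \<noteq> s" "norm (X k - s) \<le> \<delta>"
          using X(1) by (auto simp: dist_norm norm_minus_commute less_imp_le)
        hence "norm (of_real r powr (X k - 1) - complex_of_real r powr (s - 1)) / norm (X k - s)
             \<le> \<bar>ln r\<bar> * (r powr (Re s + \<delta> - 1) + r powr (Re s - \<delta> - 1))"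
          using norm_powr_diff_le[of r "X k" s \<delta>] r by (simp add: divide_le_eq)
        hence "norm (of_real r powr (X k - 1) - complex_of_real r powr (s - 1)) / norm (X k - s) * \<bar>g r\<bar>
             \<le> \<bar>ln r\<bar> * (r powr (Re s + \<delta> - 1) + r powr (Re s - \<delta> - 1)) * \<bar>g r\<bar>"
          by (rule mult_right_mono) simp
        also have "\<dots> = h r"
          by (simp add: h_def abs_mult distrib_left distrib_right mult_ac)
        finally show ?thesis
          by (simp add: norm_mult norm_divide)
      qed
      show "(\<lambda>k. ?q k r) \<longlonglongrightarrow> of_real r powr (s - 1) * complex_of_real (ln r * g r)"
        if r: "r \<in> {0<..}" for r
      proof -
        have "((\<lambda>z. of_real r powr (z - 1)) has_field_derivative of_real (ln r) * complex_of_real r powr (s - 1)) (at s)"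
          using r by (intro has_field_derivative_of_real_powr) auto
        hence "((\<lambda>w. (of_real r powr (w - 1) - of_real r powr (s - 1)) / (w - s)) \<longlongrightarrow>
                 of_real (ln r) * complex_of_real r powr (s - 1)) (at s)"
          by (simp add: has_field_derivative_iff)
        hence "(\<lambda>k. (of_real r powr (X k - 1) - of_real r powr (s - 1)) / (X k - s)) \<longlonglongrightarrow>
                 of_real (ln r) * complex_of_real r powr (s - 1)"
          using X unfolding tendsto_at_iff_sequentially o_def by blast
        from tendsto_mult_right[OF this, of "complex_of_real (g r)"] show ?thesis
          by (simp add: mult_ac)
      qed
    qed
    thus "(\<lambda>k. (mellin g (X k) - mellin g s) / (X k - s)) \<longlonglongrightarrow> mellin (\<lambda>r. ln r * g r) s"
      by (simp only: integral_unique[OF q_has] mellin_def)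
  qed
  thus ?thesis
    using \<delta> at_within_open[of s "ball s \<delta>"] by (simp add: has_field_derivative_iff)
qed

section \<open>The kernels and their Mellin transforms\<close>

definition planck_kernel :: "real \<Rightarrow> real" where
  "planck_kernel r = 1 / (exp r - 1)"

text \<open>The part of the contour integrand on the negative axis that produces harmonic
  numbers.\<close>

definition log_planck_kernel :: "real \<Rightarrow> real" where
  "log_planck_kernel r = - ln (1 - exp (- r)) / (exp r - 1)"

section \<open>Exponential series of the kernels\<close>

lemma planck_kernel_sums:
  assumes "r > 0"
  shows "(\<lambda>n. exp (- (real (Suc n) * r))) sums planck_kernel r"
proof -
  have "(\<lambda>n. exp (- r) ^ Suc n) sums (1 / (1 - exp (-r)) * exp (-r))"
    unfolding power_Suc2 using assms by (intro sums_mult2 geometric_sums) auto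
  also have "1 / (1 - exp (-r)) * exp (-r) = planck_kernel r"
    using assms by (simp add: planck_kernel_def exp_minus field_simps)
  finally show ?thesis
    by (simp only: exp_of_nat_mult[symmetric] mult_minus_right)
qed

text \<open>Cauchy product of the series of \<open>- ln (1 - x)\<close> with the geometric
  series.\<close>

lemma harm_power_sums:
  fixes x :: real
  assumes "\<bar>x\<bar> < 1"
  shows "(\<lambda>n. harm n * x ^ n) sums (- ln (1 - x) / (1 - x))"
proof -
  have x: "norm x < 1" "\<bar>\<bar>x\<bar>\<bar> < 1" using assms by auto
  \<comment> \<open>The term at \<open>n = 0\<close> is a division by zero, hence 0, so the series
    may be indexed from 0.\<close>
  have a: "(\<lambda>n. x ^ n / of_nat n) sums (- ln (1 - x))"
    using sums_minus[OF ln_series'[of "-x"]] assms by simp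
  have "(\<lambda>n. \<bar>x\<bar> ^ n / of_nat n) sums (- ln (1 - \<bar>x\<bar>))"
    using sums_minus[OF ln_series'[of "-\<bar>x\<bar>"]] assms by simp
  hence "summable (\<lambda>n. norm (x ^ n / of_nat n))"
    by (simp add: sums_iff power_abs)
  moreover have "summable (\<lambda>n. norm (x ^ n))"
    using summable_geometric[of "\<bar>x\<bar>"] assms by (simp add: power_abs)
  ultimately have "(\<lambda>n. \<Sum>i\<le>n. x ^ i / of_nat i * x ^ (n - i)) sums
      ((\<Sum>n. x ^ n / of_nat n) * (\<Sum>n. x ^ n))"
    by (rule Cauchy_product_sums)
  moreover have "(\<Sum>i\<le>n. x ^ i / of_nat i * x ^ (n - i)) = harm n * x ^ n" for n
  proof -
    have "(\<Sum>i\<le>n. x ^ i / of_nat i * x ^ (n - i)) = (\<Sum>i\<le>n. inverse (of_nat i) * x ^ n)"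
    proof (rule sum.cong)
      fix i assume "i \<in> {..n}"
      hence "x ^ n = x ^ i * x ^ (n - i)" by (simp flip: power_add)
      thus "x ^ i / of_nat i * x ^ (n - i) = inverse (of_nat i) * x ^ n"
        by (simp add: divide_inverse mult_ac)
    qed simp
    also have "\<dots> = (\<Sum>i\<le>n. inverse (of_nat i)) * x ^ n"
      by (rule sum_distrib_right[symmetric])
    also have "(\<Sum>i\<le>n. inverse (of_nat i)) = (harm n :: real)"
      unfolding harm_def by (rule sum.mono_neutral_right) (auto simp: Suc_le_eq)
    finally show ?thesis .
  qed
  ultimately show ?thesis
    using a geometric_sums[OF x(1)] by (simp add: sums_iff)
qed

text \<open>The index shift between \<open>harm n\<close> and \<open>Suc n\<close> comes from the
  extra factor in \<open>1 / (exp r - 1) = exp (-r) / (1 - exp (-r))\<close>.\<close>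

lemma log_planck_kernel_sums:
  assumes "r > 0"
  shows "(\<lambda>n. harm n * exp (- (real (Suc n) * r))) sums log_planck_kernel r"
proof -
  have "exp (- (real (Suc n) * r)) = exp (-r) ^ n * exp (-r)" for n
    by (simp add: algebra_simps flip: exp_of_nat_mult exp_add)
  moreover have "(\<lambda>n. harm n * exp (-r) ^ n * exp (-r)) sums (- ln (1 - exp (-r)) / (1 - exp (-r)) * exp (-r))"
    using assms by (intro sums_mult2 harm_power_sums) auto
  moreover have "- ln (1 - exp (-r)) / (1 - exp (-r)) * exp (-r) = log_planck_kernel r"
    using assms by (simp add: log_planck_kernel_def exp_minus field_simps)
  ultimately show ?thesis
    by (simp only: mult.assoc)
qed

section \<open>Convergence of the Dirichlet series\<close>

lemma summable_zeta_real: "\<sigma> > 1 \<Longrightarrow> summable (\<lambda>n. 1 / real (Suc n) powr \<sigma>)"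
  using summable_real_powr_iff[of "- \<sigma>"] summable_Suc_iff[of "\<lambda>n. real n powr - \<sigma>"]
  by (simp add: powr_minus_divide)

text \<open>The sequence \<open>harm (Suc n) - ln (Suc n)\<close> decreases and starts at 1.\<close>

lemma harm_le_one_plus_ln: "harm (Suc n) \<le> 1 + ln (real (Suc n))"
  using decseqD[OF decseq_harm_diff_ln, of 0 n] by (simp add: harm_Suc[of 0] harm_expand(1) del: of_nat_Suc) simp

text \<open>Harmonic numbers grow logarithmically, so they use up only a small power: with \<delta>
  half of \<open>\<sigma> - 1\<close>, the exponent \<open>\<sigma> - \<delta>\<close> that remains
  is still above 1.\<close>

lemma summable_harm_real:
  assumes "\<sigma> > 1"
  shows "summable (\<lambda>n. harm (Suc n) / real (Suc n) powr \<sigma>)"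
proof (rule summable_comparison_test')
  define \<delta> where "\<delta> = (\<sigma> - 1) / 2"
  have \<delta>: "\<delta> > 0" "\<sigma> - \<delta> > 1" using assms by (auto simp: \<delta>_def field_simps)
  show "summable (\<lambda>n. 1 / real (Suc n) powr \<sigma> + (1 / \<delta>) * (1 / real (Suc n) powr (\<sigma> - \<delta>)))"
    using \<delta> assms by (intro summable_add summable_mult summable_zeta_real)
  fix n :: nat
  have "harm (Suc n) \<le> 1 + real (Suc n) powr \<delta> / \<delta>"
    using harm_le_one_plus_ln[of n] ln_powr_bound[of "real (Suc n)" \<delta>] \<delta> by simp
  hence "harm (Suc n) / real (Suc n) powr \<sigma> \<le> (1 + real (Suc n) powr \<delta> / \<delta>) / real (Suc n) powr \<sigma>"
    by (intro divide_right_mono) auto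
  also have "\<dots> = 1 / real (Suc n) powr \<sigma> + (1 / \<delta>) * (1 / real (Suc n) powr (\<sigma> - \<delta>))"
    by (simp add: powr_diff add_divide_distrib)
  finally show "norm (harm (Suc n) / real (Suc n) powr \<sigma> :: real) \<le>
      1 / real (Suc n) powr \<sigma> + (1 / \<delta>) * (1 / real (Suc n) powr (\<sigma> - \<delta>))"
    by (simp add: harm_nonneg)
qed

lemma summable_harm_real':
  assumes "\<sigma> > 1"
  shows "summable (\<lambda>n. harm n / real (Suc n) powr \<sigma>)"
proof (rule summable_comparison_test'[OF summable_harm_real[OF assms]])
  show "norm (harm n / real (Suc n) powr \<sigma> :: real) \<le> harm (Suc n) / real (Suc n) powr \<sigma>" for n
    by (simp add: harm_nonneg divide_right_mono harm_mono)
qed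

lemma continuous_on_planck_kernel: "continuous_on {0<..} planck_kernel"
  unfolding planck_kernel_def by (intro continuous_intros) auto

lemma continuous_on_log_planck_kernel: "continuous_on {0<..} log_planck_kernel"
  unfolding log_planck_kernel_def by (intro continuous_intros) auto

lemma planck_kernel_nonneg: "r > 0 \<Longrightarrow> planck_kernel r \<ge> 0"
  by (simp add: planck_kernel_def)

lemma log_planck_kernel_nonneg: "r > 0 \<Longrightarrow> log_planck_kernel r \<ge> 0"
  by (simp add: log_planck_kernel_def divide_nonpos_pos)

lemma integrable_planck_kernel:
  assumes "\<sigma> > 1"
  shows "(\<lambda>r. r powr (\<sigma> - 1) * \<bar>planck_kernel r\<bar>) integrable_on {0<..}"
proof -
  have "(\<lambda>r. r powr (\<sigma> - 1) * planck_kernel r) integrable_on {0<..}"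
    by (rule integrable_powr_mult_exp_series[where c = "\<lambda>_. 1"])
       (use assms planck_kernel_sums summable_zeta_real[OF assms] in auto)
  thus ?thesis
    by (rule integrable_eq) (simp add: planck_kernel_nonneg)
qed

lemma integrable_log_planck_kernel:
  assumes "\<sigma> > 1"
  shows "(\<lambda>r. r powr (\<sigma> - 1) * \<bar>log_planck_kernel r\<bar>) integrable_on {0<..}"
proof -
  have "(\<lambda>r. r powr (\<sigma> - 1) * log_planck_kernel r) integrable_on {0<..}"
    by (rule integrable_powr_mult_exp_series[where c = harm])
       (use assms log_planck_kernel_sums summable_harm_real'[OF assms] in \<open>auto simp: harm_nonneg\<close>)
  thus ?thesis
    by (rule integrable_eq) (simp add: log_planck_kernel_nonneg)
qed

section \<open>Values of the Mellin transforms\<close>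

lemma mellin_planck_kernel:
  assumes "Re s > 1"
  shows "mellin planck_kernel s = Gamma s * zeta s"
proof -
  have "((\<lambda>r. of_real r powr (s - 1) * of_real (planck_kernel r)) has_integral
           Gamma s * (\<Sum>n. of_real 1 / of_nat (Suc n) powr s)) {0<..}"
    by (rule has_integral_powr_mult_exp_series[where c = "\<lambda>_. 1"])
       (use assms planck_kernel_sums summable_zeta_real[OF assms] in auto)
  thus ?thesis
    by (simp add: mellin_def zeta_def integral_unique)
qed

text \<open>The coefficient \<open>harm n\<close> of the term with base \<open>Suc n\<close> equals
  \<open>harm (Suc n) - 1 / Suc n\<close>, which splits the Dirichlet series into the two convergent
  series on the right.\<close>

lemma mellin_log_planck_kernel:
  assumes "Re s > 1"
  shows "mellin log_planck_kernel s = Gamma s * (harmonic_zeta s - zeta (s + 1))"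
proof -
  have "((\<lambda>r. of_real r powr (s - 1) * of_real (log_planck_kernel r)) has_integral
           Gamma s * (\<Sum>n. of_real (harm n) / of_nat (Suc n) powr s)) {0<..}"
    by (rule has_integral_powr_mult_exp_series)
       (use assms log_planck_kernel_sums summable_harm_real'[OF assms] in \<open>auto simp: harm_nonneg\<close>)
  moreover have "(\<Sum>n. of_real (harm n) / of_nat (Suc n) powr s) = harmonic_zeta s - zeta (s + 1)"
  proof -
    have "summable (\<lambda>n. complex_of_real (harm (Suc n)) / of_nat (Suc n) powr s)"
      by (rule summable_complex_dirichlet) (use assms summable_harm_real harm_nonneg in auto)
    moreover have "summable (\<lambda>n. complex_of_real 1 / of_nat (Suc n) powr (s + 1))"
      by (rule summable_complex_dirichlet) (use assms summable_zeta_real[of "Re s + 1"] in auto)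
    ultimately have "harmonic_zeta s - zeta (s + 1) =
        (\<Sum>n. complex_of_real (harm (Suc n)) / of_nat (Suc n) powr s - 1 / of_nat (Suc n) powr (s + 1))"
      unfolding harmonic_zeta_def zeta_def of_real_harm[where 'a = complex, symmetric]
      by (subst suminf_diff) auto
    also have "\<dots> = (\<Sum>n. of_real (harm n) / of_nat (Suc n) powr s)"
    proof (intro suminf_cong)
      fix n
      have "complex_of_nat (Suc n) powr (s + 1) = of_nat (Suc n) powr s * of_nat (Suc n)"
        by (simp add: powr_add del: of_nat_Suc)
      moreover have "complex_of_real (harm (Suc n)) = of_real (harm n) + 1 / of_nat (Suc n)"
        by (simp add: harm_Suc inverse_eq_divide del: of_nat_Suc)
      ultimately show "complex_of_real (harm (Suc n)) / of_nat (Suc n) powr s - 1 / of_nat (Suc n) powr (s + 1)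
          = of_real (harm n) / of_nat (Suc n) powr s"
        by (simp add: add_divide_distrib mult.commute del: of_nat_Suc)
    qed
    finally show ?thesis by simp
  qed
  ultimately show ?thesis
    by (simp add: mellin_def integral_unique)
qed

text \<open>The factor \<open>ln r\<close> is the derivative in \<open>s\<close> taken under the
  integral; the product rule for \<open>Gamma w * zeta w\<close> computes the same
  derivative.\<close>

lemma mellin_ln_planck_kernel:
  assumes s: "Re s > 1"
  shows "mellin (\<lambda>r. ln r * planck_kernel r) s = Gamma s * (psi s * zeta s + deriv zeta s)"
proof -
  let ?D = "mellin (\<lambda>r. ln r * planck_kernel r) s"
  have opn: "open {w. Re w > 1}" by (rule open_halfspace_Re_gt)
  have nonpole: "w \<notin> \<int>\<^sub>\<le>\<^sub>0" if "Re w > 1" for w :: complex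
    using that by (auto elim!: nonpos_Ints_cases)
  have D: "(mellin planck_kernel has_field_derivative ?D) (at s)"
    using continuous_on_planck_kernel integrable_planck_kernel s
    by (rule mellin_has_field_derivative)
  \<comment> \<open>The product rule first needs \<open>zeta\<close> to be differentiable. On the
    half-plane it equals \<open>mellin planck_kernel\<close> times the entire function
    \<open>rGamma\<close>.\<close>
  hence "((\<lambda>w. mellin planck_kernel w * rGamma w) has_field_derivative
      ?D * rGamma s + deriv rGamma s * mellin planck_kernel s) (at s)"
    by (intro DERIV_mult DERIV_deriv_iff_field_differentiable[THEN iffD2] field_differentiable_rGamma)
  hence "(zeta has_field_derivative
      ?D * rGamma s + deriv rGamma s * mellin planck_kernel s) (at s)"
    by (rule has_field_derivative_transform_within_open[OF _ opn])
       (use s nonpole in \<open>auto simp: mellin_planck_kernel rGamma_inverse_Gamma Gamma_eq_zero_iff\<close>)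
  hence zeta: "(zeta has_field_derivative deriv zeta s) (at s)"
    by (metis DERIV_imp_deriv)
  have "(Gamma has_field_derivative deriv Gamma s) (at s)"
    using has_field_derivative_Gamma[of s] nonpole[OF s] DERIV_imp_deriv by metis
  hence "((\<lambda>w. Gamma w * zeta w) has_field_derivative
            deriv Gamma s * zeta s + deriv zeta s * Gamma s) (at s)"
    using zeta by (rule DERIV_mult)
  hence "(mellin planck_kernel has_field_derivative
            deriv Gamma s * zeta s + deriv zeta s * Gamma s) (at s)"
    by (rule has_field_derivative_transform_within_open[OF _ opn])
       (use s in \<open>auto simp: mellin_planck_kernel\<close>)
  hence "?D = deriv Gamma s * zeta s + deriv zeta s * Gamma s"
    using D DERIV_unique by blast
  thus ?thesis
    using nonpole[OF s] by (simp add: psi_def Gamma_eq_zero_iff field_simps)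
qed

section \<open>The kernel of the contour integral\<close>

text \<open>This is \<open>exp z / (exp z - 1) * log_branch z\<close> at \<open>z = - r\<close>,
  written with real functions.\<close>

definition hankel_kernel :: "real \<Rightarrow> real" where
  "hankel_kernel r = - ln ((1 - exp (- r)) / r) / (exp r - 1)"

lemma hankel_kernel_split:
  "r > 0 \<Longrightarrow> hankel_kernel r = log_planck_kernel r + ln r * planck_kernel r"
  unfolding hankel_kernel_def log_planck_kernel_def planck_kernel_def
  by (subst ln_div) (auto simp: diff_divide_distrib)

lemma continuous_on_hankel_kernel: "continuous_on {0<..} hankel_kernel"
  unfolding hankel_kernel_def by (intro continuous_intros) auto

lemma integrable_hankel_kernel:
  assumes "\<sigma> > 1"
  shows "(\<lambda>r. r powr (\<sigma> - 1) * \<bar>hankel_kernel r\<bar>) integrable_on {0<..}"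
proof (rule measurable_bounded_by_integrable_imp_integrable)
  show "(\<lambda>r. r powr (\<sigma> - 1) * \<bar>hankel_kernel r\<bar>) \<in> borel_measurable (lebesgue_on {0<..})"
    by (intro continuous_imp_measurable_on_sets_lebesgue continuous_intros
          continuous_on_hankel_kernel) auto
  show "(\<lambda>r. r powr (\<sigma> - 1) * \<bar>log_planck_kernel r\<bar> + r powr (\<sigma> - 1) * \<bar>ln r * planck_kernel r\<bar>)
          integrable_on {0<..}"
    using assms
    by (intro integrable_add integrable_log_planck_kernel
          integrable_powr_mult_ln[OF continuous_on_planck_kernel integrable_planck_kernel])
  fix r :: real assume r: "r \<in> {0<..}"
  hence "norm (r powr (\<sigma> - 1) * \<bar>hankel_kernel r\<bar>) =
      r powr (\<sigma> - 1) * \<bar>log_planck_kernel r + ln r * planck_kernel r\<bar>"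
    by (simp add: hankel_kernel_split)
  also have "\<dots> \<le> r powr (\<sigma> - 1) * (\<bar>log_planck_kernel r\<bar> + \<bar>ln r * planck_kernel r\<bar>)"
    by (intro mult_left_mono abs_triangle_ineq) auto
  finally show "norm (r powr (\<sigma> - 1) * \<bar>hankel_kernel r\<bar>) \<le>
      r powr (\<sigma> - 1) * \<bar>log_planck_kernel r\<bar> + r powr (\<sigma> - 1) * \<bar>ln r * planck_kernel r\<bar>"
    by (simp add: distrib_left)
qed auto

lemma mellin_hankel_kernel:
  assumes s: "Re s > 1"
  shows "mellin hankel_kernel s =
           Gamma s * (harmonic_zeta s - zeta (s + 1) + psi s * zeta s + deriv zeta s)"
proof -
  have "mellin hankel_kernel s =
      integral {0<..} (\<lambda>r. of_real r powr (s - 1) * of_real (log_planck_kernel r)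
        + of_real r powr (s - 1) * of_real (ln r * planck_kernel r))"
    unfolding mellin_def by (intro integral_cong) (simp add: hankel_kernel_split distrib_left)
  also have "\<dots> = mellin log_planck_kernel s + mellin (\<lambda>r. ln r * planck_kernel r) s"
    unfolding mellin_def
  proof (rule integral_add)
    show "(\<lambda>r. of_real r powr (s - 1) * complex_of_real (log_planck_kernel r)) integrable_on {0<..}"
      using s by (intro mellin_integrable continuous_on_log_planck_kernel integrable_log_planck_kernel)
    show "(\<lambda>r. of_real r powr (s - 1) * complex_of_real (ln r * planck_kernel r)) integrable_on {0<..}"
      using s by (intro mellin_integrable integrable_powr_mult_ln[OF _ integrable_planck_kernel]
          continuous_on_mult continuous_on_planck_kernel continuous_on_ln continuous_on_id) auto
  qed
  finally show ?thesis
    unfolding mellin_log_planck_kernel[OF s] mellin_ln_planck_kernel[OF s]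
    by (simp add: algebra_simps)
qed

text \<open>Gives the limiting values at the poles of \<open>Gamma (1 - s)\<close>.\<close>

lemma isCont_mellin_hankel_kernel:
  assumes "Re s > 1"
  shows "isCont (mellin hankel_kernel) s"
  using mellin_has_field_derivative[OF continuous_on_hankel_kernel integrable_hankel_kernel assms]
  by (rule DERIV_isCont)

section \<open>The Hankel contour\<close>

text \<open>
  The equation for $\Phi$ says $(z^a\Phi(z))'=z^{a-1}f(z)$; a Taylor coefficient of $\Phi$ is that of $f$
  divided by $a+n$.
\<close>

lemma euler_ode_solution:
  assumes f: "f holomorphic_on ball 0 R" and a: "Re a > 0"
  obtains \<Phi> \<Phi>' :: "complex \<Rightarrow> complex"
  where "\<And>z. z \<in> ball 0 R \<Longrightarrow> (\<Phi> has_field_derivative \<Phi>' z) (at z)"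
        "\<And>z. z \<in> ball 0 R \<Longrightarrow> a * \<Phi> z + z * \<Phi>' z = f z"
proof -
  define b where "b n = (deriv ^^ n) f 0 / fact n" for n
  define c where "c n = b n / (a + of_nat n)" for n
  have nz: "a + of_nat n \<noteq> 0" for n
    using a by (auto simp: complex_eq_iff)
  have b_sums: "(\<lambda>n. b n * z ^ n) sums f z" if "norm z < R" for z
    using holomorphic_power_series[OF f, of z] that by (simp add: b_def)
  have c_sum: "summable (\<lambda>n. c n * z ^ n)" if z: "norm z < R" for z
  proof (rule summable_comparison_test')
    \<comment> \<open>A point with modulus midway between \<open>norm z\<close> and
      \<open>R\<close>: convergence at \<open>x\<close> forces absolute convergence at
      \<open>z\<close>.\<close>
    define x where "x = complex_of_real ((norm z + R) / 2)"
    have x: "norm x = (norm z + R) / 2"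
    proof -
      have "0 \<le> (norm z + R) / 2" using order_le_less_trans[OF norm_ge_zero z] by simp
      thus ?thesis unfolding x_def norm_of_real by (rule abs_of_nonneg)
    qed
    have "summable (\<lambda>n. norm (b n * z ^ n))"
    proof (rule powser_insidea)
      show "summable (\<lambda>n. b n * x ^ n)"
        using b_sums[of x] x z by (simp add: sums_iff)
      show "norm z < norm x"
        using x z by simp
    qed
    thus "summable (\<lambda>n. norm (b n * z ^ n) * (1 / Re a))"
      by (rule summable_mult2)
    fix n
    \<comment> \<open>The divisors \<open>a + n\<close> stay away from 0 uniformly, so dividing by
      them keeps the series convergent on the whole ball.\<close>
    have "Re a \<le> norm (a + of_nat n)"
      using complex_Re_le_cmod[of "a + of_nat n"] by simp
    hence "1 / norm (a + of_nat n) \<le> 1 / Re a"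
      using a by (intro divide_left_mono) (auto intro!: mult_pos_pos simp: nz)
    from mult_left_mono[OF this, of "norm (b n * z ^ n)"]
    show "norm (c n * z ^ n) \<le> norm (b n * z ^ n) * (1 / Re a)"
      by (simp add: c_def norm_mult norm_divide)
  qed
  show ?thesis
  proof (rule that)
    fix z :: complex assume "z \<in> ball 0 R"
    hence z: "norm z < R" by simp
    show "((\<lambda>z. \<Sum>n. c n * z ^ n) has_field_derivative (\<Sum>n. diffs c n * z ^ n)) (at z)"
      using c_sum z by (rule termdiffs_strong')
    have "summable (\<lambda>n. diffs c n * z ^ n)"
      using z c_sum by (rule termdiff_converges)
    from sums_mult[OF diffs_equiv[OF this], of z]
    have "(\<lambda>n. of_nat n * c n * z ^ n) sums (z * (\<Sum>n. diffs c n * z ^ n))"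
    proof (rule sums_cong[THEN iffD1, rotated])
      \<comment> \<open>At \<open>n = 0\<close> the exponent is truncated to 0, but the factor
        \<open>of_nat n\<close> vanishes there.\<close>
      show "z * (of_nat n * c n * z ^ (n - Suc 0)) = of_nat n * c n * z ^ n" for n
        by (cases n) (auto simp: mult_ac)
    qed
    moreover have "(\<lambda>n. a * (c n * z ^ n)) sums (a * (\<Sum>n. c n * z ^ n))"
      using c_sum[OF z] by (intro sums_mult summable_sums)
    ultimately have "(\<lambda>n. a * (c n * z ^ n) + of_nat n * c n * z ^ n) sums
        (a * (\<Sum>n. c n * z ^ n) + z * (\<Sum>n. diffs c n * z ^ n))"
      by (intro sums_add)
    moreover have "a * (c n * z ^ n) + of_nat n * c n * z ^ n = b n * z ^ n" for n
    proof -
      have "a * (c n * z ^ n) + of_nat n * c n * z ^ n = (a + of_nat n) * c n * z ^ n"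
        by (simp add: algebra_simps)
      also have "(a + of_nat n) * c n = b n"
        using nz[of n] by (simp add: c_def)
      finally show ?thesis .
    qed
    ultimately show "a * (\<Sum>n. c n * z ^ n) + z * (\<Sum>n. diffs c n * z ^ n) = f z"
      using b_sums[OF z] sums_unique2 by simp
  qed
qed

section \<open>The integrand near 0 and on the negative axis\<close>

text \<open>Multiplying out the quotient extends the equation of the branch to \<open>z = 0\<close>,
  where both sides vanish.\<close>

lemma exp_log_branch:
  assumes "z \<in> log_strip"
  shows "z * exp (log_branch z) = exp z - 1"
  using log_branch assms by (cases "z = 0") (auto simp: is_log_branch_def)

text \<open>
  This is the holomorphic function $\chi$ in the integrand $z^{s-2}\chi(z)$: replacing $e^z-1$ by
  $z$ times the exponential of the branch removes the singularity at $0$ without a case distinction.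
\<close>

definition hankel_factor :: "complex \<Rightarrow> complex" where
  "hankel_factor z = exp (z - log_branch z) * log_branch z"

lemma holomorphic_hankel_factor: "hankel_factor holomorphic_on log_strip"
  unfolding hankel_factor_def using log_branch
  by (auto simp: is_log_branch_def intro!: holomorphic_intros)

lemma hankel_factor_eq:
  assumes "z \<in> log_strip" "z \<noteq> 0"
  shows "hankel_factor z / z = exp z / (exp z - 1) * log_branch z"
  by (simp add: hankel_factor_def exp_diff flip: exp_log_branch[OF assms(1)])

lemma rcis_in_log_strip: "\<lbrakk>0 \<le> r; r < 2 * pi\<rbrakk> \<Longrightarrow> rcis r \<theta> \<in> log_strip"
  using abs_Im_le_cmod[of "rcis r \<theta>"] by (simp add: log_strip_def)

lemma hankel_integrand_eq:
  assumes "0 < r" "rcis r \<theta> \<in> log_strip"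
  shows "hankel_integrand s r \<theta> =
    exp ((s - 1) * (of_real (ln r) + \<i> * of_real \<theta>)) * (hankel_factor (rcis r \<theta>) / rcis r \<theta>)"
proof -
  have "rcis r \<theta> \<noteq> 0" using assms(1) by simp
  thus ?thesis using hankel_factor_eq[OF assms(2)] by (simp add: hankel_integrand_def Let_def)
qed

text \<open>The branch is real on the negative axis, and a real number is determined by its
  exponential.\<close>

lemma log_branch_neg_real:
  assumes "r > 0"
  shows "log_branch (- of_real r) = of_real (ln ((1 - exp (- r)) / r))"
proof -
  have "log_branch (of_real (- r)) \<in> \<real>"
    using log_branch assms unfolding is_log_branch_def by (metis neg_less_0_iff_less)
  then obtain y where y: "log_branch (of_real (- r)) = of_real y"
    by (auto elim: Reals_cases)
  have "- of_real r \<in> log_strip" by (simp add: log_strip_def)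
  from exp_log_branch[OF this] have "complex_of_real (- r * exp y) = of_real (exp (- r) - 1)"
    using y by (simp flip: exp_of_real)
  hence "- r * exp y = exp (- r) - 1" by (simp only: of_real_eq_iff)
  hence "exp y = (1 - exp (- r)) / r"
    using assms by (simp add: field_simps)
  hence "y = ln ((1 - exp (- r)) / r)" by (metis ln_exp)
  thus ?thesis using y by simp
qed

text \<open>The condition on \<theta> covers both sides of the cut: \<open>z = - r\<close> on each,
  and only the phase of the power tells them apart.\<close>

lemma hankel_integrand_ray:
  assumes "r > 0" "cis \<theta> = -1"
  shows "hankel_integrand s r \<theta> * cis \<theta> =
           - exp ((s - 1) * (\<i> * of_real \<theta>)) * (of_real r powr (s - 1) * of_real (hankel_kernel r))"
proof -
  have rcis: "rcis r \<theta> = - of_real r" using assms by (simp add: rcis_def)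
  have pw: "exp ((s - 1) * (of_real (ln r) + \<i> * of_real \<theta>)) =
      exp ((s - 1) * (\<i> * of_real \<theta>)) * of_real r powr (s - 1)"
    using assms by (simp add: powr_def Ln_of_real distrib_left exp_add)
  have "exp (- complex_of_real r) / (exp (- of_real r) - 1) = - of_real (1 / (exp r - 1))"
  proof -
    have "exp (- r) / (exp (- r) - 1) = - (1 / (exp r - 1))"
      using assms by (simp add: exp_minus field_simps)
    hence "complex_of_real (exp (- r) / (exp (- r) - 1)) = of_real (- (1 / (exp r - 1)))"
      by (simp only:)
    thus ?thesis by (simp flip: exp_of_real)
  qed
  hence "exp (- complex_of_real r) / (exp (- of_real r) - 1) * log_branch (- of_real r) * cis \<theta>
     = of_real (1 / (exp r - 1) * ln ((1 - exp (- r)) / r))"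
    using log_branch_neg_real[OF assms(1)] assms(2) by simp
  note kernel = this
  have "hankel_integrand s r \<theta> * cis \<theta> =
      exp ((s - 1) * (\<i> * of_real \<theta>)) * of_real r powr (s - 1) *
        (exp (- complex_of_real r) / (exp (- of_real r) - 1) * log_branch (- of_real r) * cis \<theta>)"
    unfolding hankel_integrand_def Let_def rcis pw by simp
  thus ?thesis
    unfolding kernel by (simp add: hankel_kernel_def)
qed

text \<open>The antiderivative \<open>G\<close> evaluates the arc and the missing pieces of both
  rays between 0 and \<epsilon>. Its values at the two ends of the arc cancel, which leaves the full
  Mellin integral times the difference of the phases on the two sides.\<close>

lemma hankel_integral_eq:
  assumes s: "Re s > 1" and \<epsilon>: "0 < \<epsilon>" "\<epsilon> < 2 * pi"
  shows "hankel_integral \<epsilon> s =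
    (exp ((s - 1) * (\<i> * of_real (- pi))) - exp ((s - 1) * (\<i> * of_real pi))) * mellin hankel_kernel s"
proof -
  have ball: "ball 0 (2 * pi) \<subseteq> log_strip"
    using order_le_less_trans[OF abs_Im_le_cmod] by (auto simp: log_strip_def)
  obtain \<Phi> \<Phi>' where
    \<Phi>: "\<And>z. norm z < 2 * pi \<Longrightarrow> (\<Phi> has_field_derivative \<Phi>' z) (at z)" and
    ode: "\<And>z. norm z < 2 * pi \<Longrightarrow> (s - 1) * \<Phi> z + z * \<Phi>' z = hankel_factor z"
    using euler_ode_solution[OF holomorphic_on_subset[OF holomorphic_hankel_factor ball], of "s - 1"] s
    by (auto simp: dist_norm)
  define E where "E \<theta> = exp ((s - 1) * (\<i> * of_real \<theta>))" for \<theta>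
  \<comment> \<open>The antiderivative in polar form. The angle enters through \<open>E\<close>
    because \<open>powr\<close> applied to \<open>z\<close> itself would give the same value on both
    sides of the cut.\<close>
  define G where "G r \<theta> = of_real r powr (s - 1) * E \<theta> * \<Phi> (rcis r \<theta>)" for r \<theta>
  have integrand: "hankel_integrand s r \<theta> =
      of_real r powr (s - 1) * E \<theta> * (hankel_factor (rcis r \<theta>) / rcis r \<theta>)"
    if "0 < r" "r < 2 * pi" for r \<theta>
    using that rcis_in_log_strip[of r \<theta>]
    by (simp add: hankel_integrand_eq E_def powr_def Ln_of_real distrib_left exp_add)

  have arc: "hankel_arc \<epsilon> s = G \<epsilon> pi - G \<epsilon> (- pi)"
    unfolding hankel_arc_def
  proof (rule integral_unique[OF fundamental_theorem_of_calculus])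
    fix \<theta> :: real
    let ?z = "rcis \<epsilon> \<theta>"
    have "(\<Phi> has_field_derivative \<Phi>' (of_real \<epsilon> * exp (\<i> * of_real \<theta>))) (at (of_real \<epsilon> * exp (\<i> * of_real \<theta>)))"
      using \<epsilon> by (intro \<Phi>) (simp add: norm_mult)
    \<comment> \<open>The angle is first a complex variable \<open>w\<close>, so that complex
      differentiation rules apply, and is then restricted to real values.\<close>
    hence "((\<lambda>w. of_real \<epsilon> powr (s - 1) * exp ((s - 1) * (\<i> * w)) * \<Phi> (of_real \<epsilon> * exp (\<i> * w))) has_field_derivative
        of_real \<epsilon> powr (s - 1) * (E \<theta> * (\<i> * ((s - 1) * \<Phi> ?z + ?z * \<Phi>' ?z)))) (at (of_real \<theta>))"
      by (auto intro!: derivative_eq_intros DERIV_chain2[of \<Phi>]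
          simp: E_def rcis_def cis_conv_exp algebra_simps)
    hence "((\<lambda>\<theta>. G \<epsilon> \<theta>) has_vector_derivative
        of_real \<epsilon> powr (s - 1) * (E \<theta> * (\<i> * ((s - 1) * \<Phi> ?z + ?z * \<Phi>' ?z)))) (at \<theta> within {-pi..pi})"
      unfolding G_def E_def rcis_def cis_conv_exp by (rule has_vector_derivative_real_field)
    also have "(s - 1) * \<Phi> ?z + ?z * \<Phi>' ?z = hankel_factor ?z"
      using \<epsilon> by (intro ode) simp
    also have "of_real \<epsilon> powr (s - 1) * (E \<theta> * (\<i> * hankel_factor ?z)) =
        hankel_integrand s \<epsilon> \<theta> * (\<i> * ?z)"
      using \<epsilon> by (simp add: integrand)
    finally show "(G \<epsilon> has_vector_derivative hankel_integrand s \<epsilon> \<theta> * (\<i> * ?z)) (at \<theta> within {-pi..pi})" .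
  qed simp

  have ray: "hankel_ray \<epsilon> s \<theta> = - E \<theta> * mellin hankel_kernel s - G \<epsilon> \<theta>" if \<theta>: "cis \<theta> = -1" for \<theta>
  proof -
    let ?f = "\<lambda>r. hankel_integrand s r \<theta> * cis \<theta>"
    have "(\<lambda>r. of_real r powr (s - 1) * complex_of_real (hankel_kernel r)) integrable_on {0<..}"
      using s by (intro mellin_integrable continuous_on_hankel_kernel integrable_hankel_kernel)
    hence "((\<lambda>r. - E \<theta> * (of_real r powr (s - 1) * complex_of_real (hankel_kernel r))) has_integral
        - E \<theta> * mellin hankel_kernel s) {0<..}"
      unfolding mellin_def by (intro has_integral_mult_right integrable_integral)
    hence whole: "(?f has_integral - E \<theta> * mellin hankel_kernel s) {0<..}"
      by (rule has_integral_eq[rotated]) (use \<theta> hankel_integrand_ray in \<open>auto simp: E_def\<close>)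

    \<comment> \<open>The ray from \<epsilon> is obtained as the ray from 0 minus this piece. At the
      endpoint 0 only continuity of \<open>G\<close> is shown, which holds because
      \<open>Re (s - 1) > 0\<close>.\<close>
    have "(?f has_integral G \<epsilon> \<theta> - G 0 \<theta>) {0..\<epsilon>}"
    proof (rule fundamental_theorem_of_calculus_interior)
      have "continuous_on {0..\<epsilon>} (\<lambda>r. \<Phi> (rcis r \<theta>))"
      proof (rule continuous_on_compose2[of "ball 0 (2 * pi)" \<Phi>])
        show "continuous_on (ball 0 (2 * pi)) \<Phi>"
          using \<Phi> by (intro continuous_at_imp_continuous_on ballI) (auto simp: dist_norm intro: DERIV_isCont)
        show "continuous_on {0..\<epsilon>} (\<lambda>r. rcis r \<theta>)"
          unfolding rcis_def by (intro continuous_intros)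
      qed (use \<epsilon> in auto)
      thus "continuous_on {0..\<epsilon>} (\<lambda>r. G r \<theta>)"
        unfolding G_def using s by (intro continuous_intros) auto
      fix r assume r: "r \<in> {0<..<\<epsilon>}"
      let ?z = "rcis r \<theta>"
      have norm: "norm ?z < 2 * pi" using r \<epsilon> by simp
      have "(\<Phi> has_field_derivative \<Phi>' (of_real r * cis \<theta>)) (at (of_real r * cis \<theta>))"
        using norm by (intro \<Phi>) (simp add: rcis_def)
      moreover have "((\<lambda>w. w powr (s - 1)) has_field_derivative (s - 1) * of_real r powr (s - 1 - 1)) (at (of_real r))"
        using r by (intro has_field_derivative_powr) auto
      ultimately have "((\<lambda>w. w powr (s - 1) * E \<theta> * \<Phi> (w * cis \<theta>)) has_field_derivative
          (s - 1) * of_real r powr (s - 1 - 1) * E \<theta> * \<Phi> ?z +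
          of_real r powr (s - 1) * E \<theta> * (\<Phi>' ?z * cis \<theta>)) (at (of_real r))"
        using r by (auto intro!: derivative_eq_intros DERIV_chain2[of \<Phi>] simp: rcis_def)
      hence "((\<lambda>r. G r \<theta>) has_vector_derivative
          (s - 1) * of_real r powr (s - 1 - 1) * E \<theta> * \<Phi> ?z +
          of_real r powr (s - 1) * E \<theta> * (\<Phi>' ?z * cis \<theta>)) (at r)"
        unfolding G_def rcis_def by (rule has_vector_derivative_real_field)
      also have "(s - 1) * of_real r powr (s - 1 - 1) * E \<theta> * \<Phi> ?z +
          of_real r powr (s - 1) * E \<theta> * (\<Phi>' ?z * cis \<theta>) =
          of_real r powr (s - 1) * E \<theta> * (((s - 1) * \<Phi> ?z + ?z * \<Phi>' ?z) / of_real r)"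
        using r by (simp add: powr_diff rcis_def power2_eq_square field_simps)
      also have "(s - 1) * \<Phi> ?z + ?z * \<Phi>' ?z = hankel_factor ?z"
        using norm by (rule ode)
      also have "of_real r powr (s - 1) * E \<theta> * (hankel_factor ?z / of_real r) = ?f r"
        using r \<epsilon> by (simp add: integrand rcis_def)
      finally show "((\<lambda>r. G r \<theta>) has_vector_derivative ?f r) (at r)" .
    qed (use \<epsilon> in simp)
    \<comment> \<open>The boundary term at 0 vanishes since
      \<open>0 powr (s - 1) = 0\<close>.\<close>
    hence "(?f has_integral G \<epsilon> \<theta>) {0..\<epsilon>}"
      by (simp add: G_def)
    \<comment> \<open>The sets fit together up to single points: 0 lies in
      \<open>{0..\<epsilon>}\<close> but not in \<open>{0<..}\<close>, and the difference lacks the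
      endpoint \<epsilon> of the ray.\<close>
    hence diff: "(?f has_integral - E \<theta> * mellin hankel_kernel s - G \<epsilon> \<theta>) ({0<..} - {0..\<epsilon>})"
      by (rule has_integral_setdiff[OF whole]) (rule negligible_subset[of "{0}"], auto)
    have null1: "negligible {x \<in> {0<..} - {0..\<epsilon>} - {\<epsilon>..}. ?f x \<noteq> 0}"
      by (rule negligible_subset[of "{}"]) auto
    have null2: "negligible {x \<in> {\<epsilon>..} - ({0<..} - {0..\<epsilon>}). ?f x \<noteq> 0}"
      by (rule negligible_subset[of "{\<epsilon>}"]) (use \<epsilon> in auto)
    have "(?f has_integral - E \<theta> * mellin hankel_kernel s - G \<epsilon> \<theta>) {\<epsilon>..}"
      using diff by (rule has_integral_spike_set_eq[OF null1 null2, THEN iffD1])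
    thus ?thesis
      unfolding hankel_ray_def by (rule integral_unique)
  qed
  have cis_minus_pi: "cis (- pi) = -1"
    by (simp flip: cis_inverse)
  show ?thesis
    unfolding hankel_integral_def arc ray[OF cis_pi] ray[OF cis_minus_pi]
    by (simp only: E_def) (simp add: left_diff_distrib)
qed

section \<open>Reflection formula and limiting values\<close>

text \<open>The difference of the phases is \<open>2 * \<i> * sin (pi * s)\<close>, and the
  reflection formula combines it with \<open>Gamma (1 - s)\<close> to \<open>rGamma s\<close>. The
  right-hand side stays continuous at the excluded points.\<close>

lemma hankel_F0_eq:
  assumes s: "Re s > 1" "1 - s \<notin> \<int>\<^sub>\<le>\<^sub>0" and \<epsilon>: "0 < \<epsilon>" "\<epsilon> < 2 * pi"
  shows "hankel_F0 \<epsilon> s = rGamma s * mellin hankel_kernel s"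
proof -
  have "exp ((s - 1) * (\<i> * of_real (- pi))) - exp ((s - 1) * (\<i> * of_real pi)) =
      2 * \<i> * sin (of_real pi * s)"
  proof -
    have "(s - 1) * (\<i> * of_real pi) = \<i> * (of_real pi * s) - \<i> * of_real pi"
      by (simp add: algebra_simps)
    hence "exp ((s - 1) * (\<i> * of_real pi)) = - exp (\<i> * (of_real pi * s))"
      by (simp only: exp_diff exp_pi_i') simp
    moreover have "(s - 1) * (\<i> * of_real (- pi)) = \<i> * of_real pi - \<i> * (of_real pi * s)"
      by (simp add: algebra_simps)
    hence "exp ((s - 1) * (\<i> * of_real (- pi))) = - exp (- (\<i> * (of_real pi * s)))"
      by (simp only: exp_diff exp_pi_i') (simp add: exp_minus inverse_eq_divide)
    ultimately show ?thesis by (simp add: sin_exp_eq)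
  qed
  moreover have "sin (of_real pi * s) = of_real pi * (rGamma s * rGamma (1 - s))"
    by (simp add: rGamma_reflection_complex)
  moreover have "rGamma (1 - s) \<noteq> 0"
    using s by (simp add: rGamma_eq_zero_iff)
  ultimately show ?thesis
    using s \<epsilon> by (simp add: hankel_F0_def hankel_integral_eq Gamma_def)
qed

text \<open>\<open>Lim\<close> has an unspecified value if there is no limit, so the second conjunct
  asserts that the limit in \<open>hankel_F\<close> really exists at the poles.\<close>

theorem mainTheorem1:
  fixes s :: complex and \<epsilon> :: real
  assumes "Re s > 1" and "0 < \<epsilon>" and "\<epsilon> < 2 * pi"
  shows "hankel_F \<epsilon> s = harmonic_zeta s - zeta (s + 1) + psi s * zeta s + deriv zeta s
         \<and> (1 - s \<in> \<int>\<^sub>\<le>\<^sub>0 \<longrightarrow> (hankel_F0 \<epsilon> \<longlongrightarrow> hankel_F \<epsilon> s) (at s))"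
proof -
  have "Gamma s \<noteq> 0"
    using assms(1) by (auto simp: Gamma_eq_zero_iff elim!: nonpos_Ints_cases)
  hence formula: "rGamma s * mellin hankel_kernel s =
      harmonic_zeta s - zeta (s + 1) + psi s * zeta s + deriv zeta s"
    using assms(1) by (simp add: mellin_hankel_kernel rGamma_inverse_Gamma)
  have lim: "(hankel_F0 \<epsilon> \<longlongrightarrow> rGamma s * mellin hankel_kernel s) (at s)"
    if pole: "1 - s \<in> \<int>\<^sub>\<le>\<^sub>0"
  proof (rule Lim_transform_eventually)
    show "((\<lambda>w. rGamma w * mellin hankel_kernel w) \<longlongrightarrow> rGamma s * mellin hankel_kernel s) (at s)"
      using isCont_mellin_hankel_kernel[OF assms(1)]
        field_differentiable_imp_continuous_at[OF field_differentiable_rGamma, of s UNIV]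
      by (intro tendsto_mult) (simp_all add: isCont_def)
    have "eventually (\<lambda>w. w \<in> {w. Re w > 1}) (at s)"
      using assms(1) by (intro eventually_at_in_open' open_halfspace_Re_gt) auto
    \<comment> \<open>Radius 1 suffices: the poles are integers, so the punctured unit ball around
      one of them contains no other.\<close>
    moreover have "eventually (\<lambda>w. w \<in> ball s 1 - {s}) (at s)"
      by (intro eventually_at_in_open) auto
    ultimately show "eventually (\<lambda>w. rGamma w * mellin hankel_kernel w = hankel_F0 \<epsilon> w) (at s)"
    proof eventually_elim
      case (elim w)
      have "1 - w \<notin> \<int>\<^sub>\<le>\<^sub>0"
      proof
        assume "1 - w \<in> \<int>\<^sub>\<le>\<^sub>0"
        with pole obtain m n :: int where "1 - w = of_int m" "1 - s = of_int n"
          by (auto elim!: nonpos_Ints_cases)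
        hence "s - w = of_int (m - n)" by (simp add: algebra_simps)
        hence "norm (complex_of_int (m - n)) < 1" "m \<noteq> n"
          using elim(2) by (auto simp: dist_norm)
        thus False by (simp only: norm_of_int)
      qed
      thus ?case
        using elim(1) assms by (simp add: hankel_F0_eq)
    qed
  qed
  have "hankel_F \<epsilon> s = rGamma s * mellin hankel_kernel s"
  proof (cases "1 - s \<in> \<int>\<^sub>\<le>\<^sub>0")
    case True
    thus ?thesis
      using tendsto_Lim[OF _ lim[OF True]] by (simp add: hankel_F_def)
  next
    case False
    thus ?thesis
      using assms by (simp add: hankel_F_def hankel_F0_eq)
  qed
  thus ?thesis
    using formula lim by simp
qed

end
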